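(* Let $G\cong \mathbb{Z}^{(k)}\oplus \mathbb{Z}_{n_1}\oplus\cdots\oplus \mathbb{Z}_{n_t}$ be a finitely generated abelian group, where $n_{i+1}\mid n_i$ for all $1\leq i \leq t-1$. Then $G$ is $\mathfrak{S}_2$-capable if and only if $k\geq 3$, or $k=0$, $t\geq 3$, and $n_1=n_2=n_3$.
   Context: $\mathbb{Z}_n$ is the cyclic group of order $n$ and $\mathbb{Z}^{(k)}$ is the direct sum of $k$ copies of $\mathbb{Z}$. $\mathfrak{S}_2=[\mathfrak{N}_1,\mathfrak{N}_1]$ is the variety of metabelian groups (solvable of length at most 2), defined by the word $[[x_1,x_2],[y_1,y_2]]$. For a set of words $V$ defining a variety $\mathfrak V$ and a group $E$, the marginal subgroup $V^*(E)$ is the set of all $a\in E$ such that $v(g_1,\dots,g_{i-1},g_ia,g_{i+1},\dots,g_n)=v(g_1,\dots,g_n)$ for all $v\in V$, all $g_1,\dots,g_n\in E$ and all $1\le i\le n$. A group $G$ is $\mathfrak V$-capable if there is a group $E$ with $G\cong E/V^*(E)$.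
   Formalization: G is assumed nontrivial: the trivial group (k = 0 with t = 0, or k = 0, t < 3 and all n_i = 1) is S_2-capable (take E trivial) but does not satisfy the stated condition, so the claim as printed fails for it. *)

theory Defs
  imports "HOL-Algebra.Algebra"
begin

text \<open>
  A word in the variables \<open>x\<^sub>0, x\<^sub>1, \<dots>\<close> is a list of letters; the letter \<open>(i, True)\<close> stands for
  \<open>x\<^sub>i\<close> and \<open>(i, False)\<close> for the inverse of \<open>x\<^sub>i\<close>. Words need not be freely reduced, as only their
  values in groups matter.
\<close>

type_synonym word = "(nat \<times> bool) list"

definition word_value :: "('e, 'm) monoid_scheme \<Rightarrow> (nat \<Rightarrow> 'e) \<Rightarrow> word \<Rightarrow> 'e" where
  "word_value E g w =
     foldr (\<lambda>(i, b) y. (if b then g i else inv\<^bsub>E\<^esub> (g i)) \<otimes>\<^bsub>E\<^esub> y) w \<one>\<^bsub>E\<^esub>"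

definition word_inverse :: "word \<Rightarrow> word" where
  "word_inverse w = rev (map (\<lambda>(i, b). (i, \<not> b)) w)"

definition word_commutator :: "word \<Rightarrow> word \<Rightarrow> word" where
  "word_commutator u w = word_inverse u @ word_inverse w @ u @ w"

definition word_var :: "nat \<Rightarrow> word" where
  "word_var i = [(i, True)]"

text \<open>The variety of metabelian groups, given by its defining word
  \<open>[[x\<^sub>0, x\<^sub>1], [x\<^sub>2, x\<^sub>3]]\<close>.\<close>

definition metabelian_words :: "word set" where
  "metabelian_words =
     {word_commutator (word_commutator (word_var 0) (word_var 1))
                      (word_commutator (word_var 2) (word_var 3))}"

text \<open>Arguments are supplied for all variables at once, so \<open>i\<close> ranges over all
  indices; for variables that do not occur in \<open>v\<close> the condition holds trivially.\<close>

definition marginal_subgroup :: "word set \<Rightarrow> ('e, 'm) monoid_scheme \<Rightarrow> 'e set" where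
  "marginal_subgroup V E =
     {a \<in> carrier E. \<forall>v \<in> V. \<forall>g \<in> UNIV \<rightarrow> carrier E. \<forall>i.
        word_value E (g(i := g i \<otimes>\<^bsub>E\<^esub> a)) v = word_value E g v}"

text \<open>
  HOL cannot quantify existentially over types, so the type \<open>'e\<close> in which the group \<open>E\<close> lives is
  a parameter. For the direct sums of cyclic groups considered here, which are countable, the
  notion is the same for every infinite type \<open>'e\<close>: if \<open>E\<close> is any group and \<open>E / V\<^sup>*(E)\<close> is
  countable, then some countable subgroup \<open>F\<close> of \<open>E\<close> with \<open>F V\<^sup>*(E) = E\<close> contains, for each of its
  elements outside \<open>V\<^sup>*(E)\<close>, arguments witnessing this; hence \<open>V\<^sup>*(F) = F \<inter> V\<^sup>*(E)\<close> and
  \<open>F / V\<^sup>*(F)\<close> is isomorphic to \<open>E / V\<^sup>*(E)\<close>, and a countable group has a copy in every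
  infinite type.
\<close>

definition variety_capable ::
    "'e itself \<Rightarrow> word set \<Rightarrow> ('a, 'm) monoid_scheme \<Rightarrow> bool" where
  "variety_capable (T :: 'e itself) V G \<longleftrightarrow>
     (\<exists>E :: 'e monoid. group E \<and> G \<cong> E Mod marginal_subgroup V E)"

text \<open>Below, \<open>V\<^sup>*(E)\<close> is shown to be normal, so that \<open>Mod\<close> is indeed a quotient group.\<close>

lemma word_value_Nil [simp]: "word_value E g [] = \<one>\<^bsub>E\<^esub>"
  by (simp add: word_value_def)

lemma word_value_Cons [simp]:
  "word_value E g ((i, b) # w) =
     (if b then g i else inv\<^bsub>E\<^esub> (g i)) \<otimes>\<^bsub>E\<^esub> word_value E g w"
  by (simp add: word_value_def)

context group
begin

lemma word_value_closed [simp]: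
  assumes "g \<in> UNIV \<rightarrow> carrier G"
  shows "word_value G g w \<in> carrier G"
  using assms by (induction w) (auto simp: Pi_iff)

lemma word_value_append:
  assumes "g \<in> UNIV \<rightarrow> carrier G"
  shows "word_value G g (u @ w) = word_value G g u \<otimes> word_value G g w"
  using assms by (induction u) (auto simp: Pi_iff m_assoc)

lemma word_value_inverse:
  assumes "g \<in> UNIV \<rightarrow> carrier G"
  shows "word_value G g (word_inverse w) = inv (word_value G g w)"
  using assms
  by (induction w) (auto simp: word_inverse_def Pi_iff word_value_append inv_mult_group)

lemma word_value_commutator:
  assumes "g \<in> UNIV \<rightarrow> carrier G"
  shows "word_value G g (word_commutator u w) =
           inv (word_value G g u) \<otimes> inv (word_value G g w) \<otimes> word_value G g u \<otimes> word_value G g w"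
  using assms by (simp add: word_commutator_def word_value_append word_value_inverse m_assoc)

lemma word_value_conj:
  assumes g: "g \<in> UNIV \<rightarrow> carrier G" and x: "x \<in> carrier G"
  shows "word_value G (\<lambda>j. x \<otimes> g j \<otimes> inv x) w = x \<otimes> word_value G g w \<otimes> inv x"
proof (induction w)
  case Nil
  then show ?case using x by simp
next
  case (Cons l w)
  obtain i b where l: "l = (i, b)" by fastforce
  have gi: "g i \<in> carrier G" using g by auto
  have *: "(x \<otimes> y \<otimes> inv x) \<otimes> (x \<otimes> z \<otimes> inv x) = x \<otimes> (y \<otimes> z) \<otimes> inv x"
    if "y \<in> carrier G" "z \<in> carrier G" for y z
    using that x by (simp add: m_assoc inv_solve_left')
  have "inv (x \<otimes> g i \<otimes> inv x) = x \<otimes> inv (g i) \<otimes> inv x"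
    using gi x by (simp add: inv_mult_group m_assoc)
  then show ?case using Cons * gi g by (simp add: l)
qed

lemma marginal_subgroup_normal: "marginal_subgroup V G \<lhd> G"
proof -
  let ?M = "marginal_subgroup V G"
  have D: "word_value G (g(i := g i \<otimes> a)) v = word_value G g v"
    if "a \<in> ?M" "v \<in> V" "g \<in> UNIV \<rightarrow> carrier G" for a v g i
    using that by (simp add: marginal_subgroup_def)
  have C: "a \<in> carrier G" if "a \<in> ?M" for a
    using that by (simp add: marginal_subgroup_def)
  have "subgroup ?M G"
  proof (rule subgroupI)
    show "?M \<subseteq> carrier G" using C by blast
    have "g(i := g i \<otimes> \<one>) = g" if "g \<in> UNIV \<rightarrow> carrier G" for g :: "nat \<Rightarrow> 'a" and i
      using that by (auto simp: fun_eq_iff Pi_iff)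
    then have "\<one> \<in> ?M" by (simp add: marginal_subgroup_def)
    then show "?M \<noteq> {}" by blast
  next
    fix a assume a: "a \<in> ?M"
    show "inv a \<in> ?M" unfolding marginal_subgroup_def
    proof (intro CollectI conjI ballI allI)
      show "inv a \<in> carrier G" using C a by simp
      fix v and g :: "nat \<Rightarrow> 'a" and i assume v: "v \<in> V" and g: "g \<in> UNIV \<rightarrow> carrier G"
      let ?h = "g(i := g i \<otimes> inv a)"
      have h: "?h \<in> UNIV \<rightarrow> carrier G" using g C a by (auto simp: Pi_iff)
      have "?h(i := ?h i \<otimes> a) = g" using g C[OF a] by (auto simp: fun_eq_iff Pi_iff m_assoc)
      then show "word_value G ?h v = word_value G g v" using D[OF a v h, of i] by simp
    qed
  next
    fix a b assume a: "a \<in> ?M" and b: "b \<in> ?M"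
    show "a \<otimes> b \<in> ?M" unfolding marginal_subgroup_def
    proof (intro CollectI conjI ballI allI)
      show "a \<otimes> b \<in> carrier G" using C a b by simp
      fix v and g :: "nat \<Rightarrow> 'a" and i assume v: "v \<in> V" and g: "g \<in> UNIV \<rightarrow> carrier G"
      let ?h = "g(i := g i \<otimes> a)"
      have h: "?h \<in> UNIV \<rightarrow> carrier G" using g C a by (auto simp: Pi_iff)
      have "?h(i := ?h i \<otimes> b) = g(i := g i \<otimes> (a \<otimes> b))"
        using g C[OF a] C[OF b] by (auto simp: fun_eq_iff Pi_iff m_assoc)
      then show "word_value G (g(i := g i \<otimes> (a \<otimes> b))) v = word_value G g v"
        using D[OF b v h, of i] D[OF a v g, of i] by simp
    qed
  qed
  moreover have "x \<otimes> a \<otimes> inv x \<in> ?M" if x: "x \<in> carrier G" and a: "a \<in> ?M" for x a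
    unfolding marginal_subgroup_def
  proof (intro CollectI conjI ballI allI)
    show "x \<otimes> a \<otimes> inv x \<in> carrier G" using C a x by simp
    fix v and g :: "nat \<Rightarrow> 'a" and i assume v: "v \<in> V" and g: "g \<in> UNIV \<rightarrow> carrier G"
    have gj: "g j \<in> carrier G" for j using g by auto
    define h where "h = (\<lambda>j. inv x \<otimes> g j \<otimes> x)"
    have h: "h \<in> UNIV \<rightarrow> carrier G" using g x by (auto simp: h_def Pi_iff)
    have h': "h(i := h i \<otimes> a) \<in> UNIV \<rightarrow> carrier G" using h C a by (auto simp: Pi_iff)
    have xx: "x \<otimes> (inv x \<otimes> y) = y" if "y \<in> carrier G" for y
      using that x by (simp add: m_assoc[symmetric])
    have 1: "(\<lambda>j. x \<otimes> h j \<otimes> inv x) = g"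
      using x gj by (auto simp: h_def fun_eq_iff m_assoc xx)
    have 2: "(\<lambda>j. x \<otimes> (h(i := h i \<otimes> a)) j \<otimes> inv x) = g(i := g i \<otimes> (x \<otimes> a \<otimes> inv x))"
      using x gj C[OF a] by (auto simp: h_def fun_eq_iff m_assoc xx)
    show "word_value G (g(i := g i \<otimes> (x \<otimes> a \<otimes> inv x))) v = word_value G g v"
      using word_value_conj[OF h x, of v] word_value_conj[OF h' x, of v] D[OF a v h, of i]
      unfolding 1 2 by simp
  qed
  ultimately show ?thesis by (simp add: normal_inv_iff)
qed

end

end

(* The word w(x, y, z, u) = [[x, y], [z, u]] takes on a group E whose marginal quotient G is abelian
   values that depend only on the classes in G. Since E' is contained in the marginal subgroup,
   [E', E] centralises E', which makes w additive in each variable: it is an alternating form on the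
   exterior square of G, and capability of G forces this form to have no radical. If all but two of
   the cyclic summands are killed by N, then N times the first generator lies in the radical,
   because moving N to the other variables leaves only the subgroup generated by two elements, whose
   exterior square is cyclic. Hence this multiple is zero, which gives the conditions on k and
   n_1, n_2, n_3.

   Conversely, in the group of upper unitriangular 5 x 5 matrices the word w depends only on the
   superdiagonals, being (x_1 y_2 - y_1 x_2) (z_3 u_4 - u_3 z_4) - (z_1 u_2 - u_1 z_2)
   (x_3 y_4 - y_3 x_4) in the corner entry. For every cyclic summand i of G, of order m_i, choose two
   further summands p and q whose orders are multiples of m_i and put the coordinates (i, p, p, q) on
   the superdiagonal, with the corner entry taken modulo m_i. Evaluating at (a, e_p, e_p, e_q) recovers
   the coordinate a_i modulo m_i, so the common form of these families of matrices has no radical. *)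
theory Submission
  imports Defs
begin

section \<open>Commutators and the marginal subgroup\<close>

definition commutator :: "('a, 'm) monoid_scheme \<Rightarrow> 'a \<Rightarrow> 'a \<Rightarrow> 'a" where
  "commutator G x y = inv\<^bsub>G\<^esub> x \<otimes>\<^bsub>G\<^esub> inv\<^bsub>G\<^esub> y \<otimes>\<^bsub>G\<^esub> x \<otimes>\<^bsub>G\<^esub> y"

definition double_commutator :: "('a, 'm) monoid_scheme \<Rightarrow> 'a \<Rightarrow> 'a \<Rightarrow> 'a \<Rightarrow> 'a \<Rightarrow> 'a" where
  "double_commutator G x y z u = commutator G (commutator G x y) (commutator G z u)"

section \<open>Elementary commutator identities\<close>

context group
begin

lemma mult_inv_cancel:
  assumes "x \<in> carrier G" "y \<in> carrier G"
  shows "inv x \<otimes> (x \<otimes> y) = y" and "x \<otimes> (inv x \<otimes> y) = y"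
  using assms by (simp_all add: m_assoc[symmetric])

text \<open>These rules push inverses to the letters, associate to the right and cancel neighbours,
  so that \<open>simp\<close> proves identities of free groups.\<close>

lemmas group_word_simps = m_assoc inv_mult_group mult_inv_cancel

lemma commutator_closed [simp]:
  "x \<in> carrier G \<Longrightarrow> y \<in> carrier G \<Longrightarrow> commutator G x y \<in> carrier G"
  by (simp add: commutator_def)

lemma double_commutator_closed [simp]:
  "\<lbrakk>x \<in> carrier G; y \<in> carrier G; z \<in> carrier G; u \<in> carrier G\<rbrakk>
    \<Longrightarrow> double_commutator G x y z u \<in> carrier G"
  by (simp add: double_commutator_def)

text \<open>\<open>[x, y]\<close> is the inverse of \<open>y x\<close> times \<open>x y\<close>. The
  form without inverses suits matrices, whose products are simpler than their inverses.\<close>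

lemma commutator_eq_iff:
  assumes "x \<in> carrier G" "y \<in> carrier G" "c \<in> carrier G"
  shows "commutator G x y = c \<longleftrightarrow> y \<otimes> x \<otimes> c = x \<otimes> y"
proof -
  have "commutator G x y = inv (y \<otimes> x) \<otimes> (x \<otimes> y)"
    using assms by (simp add: commutator_def group_word_simps)
  then show ?thesis
    using assms by (metis inv_solve_left m_closed)
qed

lemma commutator_eq_one_iff:
  assumes "x \<in> carrier G" "y \<in> carrier G"
  shows "commutator G x y = \<one> \<longleftrightarrow> x \<otimes> y = y \<otimes> x"
  using assms commutator_eq_iff[of x y \<one>] by auto

lemma commutator_one [simp]:
  assumes "x \<in> carrier G"
  shows "commutator G \<one> x = \<one>" "commutator G x \<one> = \<one>" "commutator G x x = \<one>"
  using assms by (simp_all add: commutator_eq_one_iff)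

lemma inv_commutator:
  assumes "x \<in> carrier G" "y \<in> carrier G"
  shows "inv (commutator G x y) = commutator G y x"
  using assms by (simp add: commutator_def group_word_simps)

lemma commutator_mult_left:
  assumes "x \<in> carrier G" "x' \<in> carrier G" "y \<in> carrier G"
  shows "commutator G (x \<otimes> x') y = inv x' \<otimes> commutator G x y \<otimes> x' \<otimes> commutator G x' y"
  using assms by (simp add: commutator_def group_word_simps)

text \<open>The set is a kernel. This lets the vanishing of a multiplicative map spread from
  generators to the whole group.\<close>

lemma subgroup_vanishing:
  assumes "\<And>x. x \<in> carrier G \<Longrightarrow> f x \<in> carrier G"
    and f: "\<And>x y. x \<in> carrier G \<Longrightarrow> y \<in> carrier G \<Longrightarrow> f (x \<otimes> y) = f x \<otimes> f y"
  shows "subgroup {x \<in> carrier G. f x = \<one>} G"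
proof -
  interpret group_hom G G f
    using assms by unfold_locales (auto simp: hom_def)
  show ?thesis using subgroup_kernel by (simp add: kernel_def)
qed

section \<open>The marginal condition for the metabelian word\<close>

lemma word_value_metabelian:
  assumes "g \<in> UNIV \<rightarrow> carrier G"
  shows "word_value G g (word_commutator (word_commutator (word_var 0) (word_var 1))
                      (word_commutator (word_var 2) (word_var 3)))
    = double_commutator G (g 0) (g 1) (g 2) (g 3)"
proof -
  have "g i \<in> carrier G" for i using assms by auto
  then show ?thesis
    using assms
    by (simp add: word_value_commutator double_commutator_def commutator_def word_var_def)
qed

lemma mem_marginal_metabelian_iff:
  "a \<in> marginal_subgroup metabelian_words G \<longleftrightarrow> a \<in> carrier G \<and>
    (\<forall>x\<in>carrier G. \<forall>y\<in>carrier G. \<forall>z\<in>carrier G. \<forall>u\<in>carrier G.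
      double_commutator G (x \<otimes> a) y z u = double_commutator G x y z u \<and>
      double_commutator G x (y \<otimes> a) z u = double_commutator G x y z u \<and>
      double_commutator G x y (z \<otimes> a) u = double_commutator G x y z u \<and>
      double_commutator G x y z (u \<otimes> a) = double_commutator G x y z u)"
    (is "_ \<longleftrightarrow> _ \<and> ?R")
proof
  assume a: "a \<in> marginal_subgroup metabelian_words G"
  then have ac: "a \<in> carrier G" by (simp add: marginal_subgroup_def)
  {
    fix x y z u assume c: "x \<in> carrier G" "y \<in> carrier G" "z \<in> carrier G" "u \<in> carrier G"
    \<comment> \<open>An assignment with the prescribed first four values; the value
      \<open>u\<close> for later variables is arbitrary, since they do not occur in the
      word.\<close>
    define g where "g j = (if j = 0 then x else if j = 1 then y else if j = 2 then z else u)" for j :: nat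
    have g: "g \<in> UNIV \<rightarrow> carrier G" using c by (auto simp: g_def)
    then have g': "g(i := g i \<otimes> a) \<in> UNIV \<rightarrow> carrier G" for i using ac by (auto simp: Pi_iff)
    have *: "double_commutator G ((g(i := g i \<otimes> a)) 0) ((g(i := g i \<otimes> a)) 1)
            ((g(i := g i \<otimes> a)) 2) ((g(i := g i \<otimes> a)) 3)
          = double_commutator G (g 0) (g 1) (g 2) (g 3)" for i
      using a g unfolding marginal_subgroup_def metabelian_words_def

      by (simp only: word_value_metabelian[OF g, symmetric] word_value_metabelian[OF g', symmetric])
        (use g in blast)
    note *[of 0] *[of 1] *[of 2] *[of 3]
  }
  note 1 = this
  show "a \<in> carrier G \<and> ?R"
  proof (intro conjI ballI ac)
    fix x y z u assume c: "x \<in> carrier G" "y \<in> carrier G" "z \<in> carrier G" "u \<in> carrier G"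
    show "double_commutator G (x \<otimes> a) y z u = double_commutator G x y z u"
      "double_commutator G x (y \<otimes> a) z u = double_commutator G x y z u"
      "double_commutator G x y (z \<otimes> a) u = double_commutator G x y z u"
      "double_commutator G x y z (u \<otimes> a) = double_commutator G x y z u"
      using 1[OF c] by simp_all
  qed
next
  assume a: "a \<in> carrier G \<and> ?R"
  have "word_value G (g(i := g i \<otimes> a)) v = word_value G g v"
    if v: "v \<in> metabelian_words" and g: "g \<in> UNIV \<rightarrow> carrier G" for g i v
  proof -
    have g': "g(i := g i \<otimes> a) \<in> UNIV \<rightarrow> carrier G" using a g by (auto simp: Pi_iff)
    have "g j \<in> carrier G" for j using g by auto
    then show ?thesis
      using a v unfolding metabelian_words_def
      by (simp only: word_value_metabelian[OF g] word_value_metabelian[OF g'] singleton_iff) simp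
  qed
  with a show "a \<in> marginal_subgroup metabelian_words G"
    by (auto simp: marginal_subgroup_def)
qed

end

section \<open>The alternating form of a group whose marginal quotient is abelian\<close>

locale abelian_marginal_quotient = group +
  assumes commutator_marginal:
    "x \<in> carrier G \<Longrightarrow> y \<in> carrier G \<Longrightarrow>
      commutator G x y \<in> marginal_subgroup metabelian_words G"
begin

abbreviation "M \<equiv> marginal_subgroup metabelian_words G"

lemma M_carrier [simp]: "a \<in> M \<Longrightarrow> a \<in> carrier G"
  by (simp add: marginal_subgroup_def)

text \<open>Replacing the marginal \<open>c\<close> by \<open>\<one>\<close> does not change
  \<open>[[c, y], [z, u]]\<close>, so this double commutator is trivial.\<close>

lemma marginal_commutator_commutes:
  assumes "c \<in> M" "y \<in> carrier G" "z \<in> carrier G" "u \<in> carrier G"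
  shows "commutator G c y \<otimes> commutator G z u = commutator G z u \<otimes> commutator G c y"
proof -
  have "double_commutator G (\<one> \<otimes> c) y z u = double_commutator G \<one> y z u"
    using assms mem_marginal_metabelian_iff by blast
  also have "\<dots> = \<one>" using assms by (simp add: double_commutator_def)
  finally show ?thesis
    using assms by (simp add: double_commutator_def commutator_eq_one_iff)
qed

text \<open>The preceding lemma with \<open>[x, y]\<close> as the marginal element. In particular
  values of the double commutator commute with each other, as additivity requires.\<close>

lemma double_commutator_commute:
  assumes "x \<in> carrier G" "y \<in> carrier G" "z \<in> carrier G" "u \<in> carrier G"
    and "p \<in> carrier G" "q \<in> carrier G"
  shows "double_commutator G x y z u \<otimes> commutator G p q
    = commutator G p q \<otimes> double_commutator G x y z u"
  unfolding double_commutator_def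
  using assms by (intro marginal_commutator_commutes commutator_marginal) auto

lemma double_commutator_swap:
  assumes "x \<in> carrier G" "y \<in> carrier G" "z \<in> carrier G" "u \<in> carrier G"
  shows "double_commutator G z u x y = inv (double_commutator G x y z u)"
  using assms by (simp add: double_commutator_def inv_commutator)

text \<open>For \<open>D = [x, y]\<close> and \<open>v = [z, u]\<close>, the commutator of the
  inverse of \<open>D\<close> with \<open>v\<close> is a conjugate by \<open>D\<close> of the
  inverse of \<open>[D, v]\<close>, and \<open>[D, v]\<close> commutes with
  \<open>D\<close>.\<close>

lemma double_commutator_swap_left:
  assumes "x \<in> carrier G" "y \<in> carrier G" "z \<in> carrier G" "u \<in> carrier G"
  shows "double_commutator G y x z u = inv (double_commutator G x y z u)"
proof -
  define D v where "D = commutator G x y" and "v = commutator G z u"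
  have c: "D \<in> carrier G" "v \<in> carrier G" using assms by (simp_all add: D_def v_def)
  have "double_commutator G y x z u = commutator G (inv D) v"
    using assms by (simp add: double_commutator_def D_def v_def inv_commutator)
  also have "\<dots> = D \<otimes> (inv (commutator G D v) \<otimes> inv D)"
    using c by (simp add: commutator_def group_word_simps)
  also have "inv (commutator G D v) \<otimes> inv D = inv D \<otimes> inv (commutator G D v)"
  proof -
    have "D \<otimes> commutator G D v = commutator G D v \<otimes> D"
      using double_commutator_commute[OF assms assms(1,2)]
      by (simp add: D_def v_def double_commutator_def)
    then have "inv (D \<otimes> commutator G D v) = inv (commutator G D v \<otimes> D)" by simp
    then show ?thesis using c by (simp add: inv_mult_group)
  qed
  finally show ?thesis
    using c by (simp add: mult_inv_cancel double_commutator_def D_def v_def)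
qed

text \<open>With \<open>D = [x, y]\<close> and \<open>e = [D, x']\<close> one has \<open>[x x', y] = D e [x', y]\<close>. As \<open>D\<close> is marginal,
  \<open>e\<close> commutes with all commutators and drops out of the double commutator.\<close>

lemma double_commutator_mult1:
  assumes "x \<in> carrier G" "x' \<in> carrier G" "y \<in> carrier G" "z \<in> carrier G" "u \<in> carrier G"
  shows "double_commutator G (x \<otimes> x') y z u
    = double_commutator G x y z u \<otimes> double_commutator G x' y z u"
proof -
  define D D' v e where "D = commutator G x y" and "D' = commutator G x' y"
    and "v = commutator G z u" and "e = commutator G D x'"
  have c: "D \<in> carrier G" "v \<in> carrier G" "D' \<in> carrier G" "e \<in> carrier G"
    using assms by (simp_all add: D_def v_def D'_def e_def)
  have DM: "D \<in> M" using assms by (simp add: D_def commutator_marginal)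
  have ev: "e \<otimes> v = v \<otimes> e" and eD: "e \<otimes> D = D \<otimes> e" and eD': "e \<otimes> D' = D' \<otimes> e"
    using marginal_commutator_commutes[OF DM \<open>x' \<in> _\<close>] assms
    by (simp_all add: e_def D_def D'_def v_def)
  have "commutator G (x \<otimes> x') y = D \<otimes> e \<otimes> D'"
    using assms by (simp add: D_def e_def D'_def commutator_def group_word_simps)
  also have "\<dots> = D \<otimes> D' \<otimes> e" using c eD' by (simp add: m_assoc)
  finally have 1: "commutator G (x \<otimes> x') y = D \<otimes> D' \<otimes> e" .
  have "commutator G (D \<otimes> D' \<otimes> e) v = commutator G (D \<otimes> D') v"
  proof -
    have X: "e \<otimes> commutator G (D \<otimes> D') v = commutator G (D \<otimes> D') v \<otimes> e"
    proof -
      \<comment> \<open>The centraliser of \<open>e\<close>: being closed under products and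
        inverses, it contains every word in \<open>D\<close>, \<open>D'\<close> and
        \<open>v\<close>.\<close>
      define S where "S = {h \<in> carrier G. e \<otimes> h = h \<otimes> e}"
      have Sm: "h \<otimes> k \<in> S" if "h \<in> S" "k \<in> S" for h k
        using that c by (simp add: S_def) (metis m_assoc)
      have Si: "inv h \<in> S" if "h \<in> S" for h
      proof -
        have h: "h \<in> carrier G" "e \<otimes> h = h \<otimes> e" using that by (simp_all add: S_def)
        have "inv h \<otimes> (e \<otimes> h) \<otimes> inv h = inv h \<otimes> (h \<otimes> e) \<otimes> inv h" by (simp only: h)
        then show ?thesis using h(1) c by (simp add: S_def m_assoc mult_inv_cancel)
      qed
      have "D \<in> S" "D' \<in> S" "v \<in> S" using c ev eD eD' by (simp_all add: S_def)
      then have "commutator G (D \<otimes> D') v \<in> S"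
        unfolding commutator_def by (intro Sm Si)
      then show ?thesis by (simp add: S_def)
    qed
    have "commutator G (D \<otimes> D' \<otimes> e) v
        = inv e \<otimes> commutator G (D \<otimes> D') v \<otimes> e \<otimes> commutator G e v"
      using c by (intro commutator_mult_left) auto
    also have "commutator G e v = \<one>" using c ev by (simp add: commutator_eq_one_iff)
    also have "inv e \<otimes> commutator G (D \<otimes> D') v \<otimes> e = inv e \<otimes> (e \<otimes> commutator G (D \<otimes> D') v)"
      using c by (simp add: X m_assoc)
    finally show ?thesis using c by (simp add: mult_inv_cancel)
  qed
  also have "\<dots> = inv D' \<otimes> commutator G D v \<otimes> D' \<otimes> commutator G D' v"
    using c by (intro commutator_mult_left) auto
  also have "\<dots> = inv D' \<otimes> (commutator G D v \<otimes> D') \<otimes> commutator G D' v"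
    using c by (simp add: m_assoc)
  also have "commutator G D v \<otimes> D' = D' \<otimes> commutator G D v"
    using double_commutator_commute[OF assms(1,3-5,2,3)]
    by (simp add: D_def D'_def v_def double_commutator_def)
  finally show ?thesis
    unfolding double_commutator_def[of G "x \<otimes> x'"] 1 using c
    by (simp add: m_assoc mult_inv_cancel double_commutator_def flip: D_def D'_def v_def)
qed

text \<open>Antisymmetry transfers additivity from the first variable. Inversion reverses the two
  factors, and they commute.\<close>

lemma double_commutator_mult2:
  assumes "x \<in> carrier G" "y \<in> carrier G" "y' \<in> carrier G" "z \<in> carrier G" "u \<in> carrier G"
  shows "double_commutator G x (y \<otimes> y') z u
    = double_commutator G x y z u \<otimes> double_commutator G x y' z u"
proof -
  have "double_commutator G x (y \<otimes> y') z u
      = inv (double_commutator G y x z u \<otimes> double_commutator G y' x z u)"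
    using assms double_commutator_swap_left[of "y \<otimes> y'" x z u] double_commutator_mult1 by simp
  also have "\<dots> = inv (double_commutator G y' x z u \<otimes> double_commutator G y x z u)"
    using double_commutator_commute[of y x z u "commutator G y' x" "commutator G z u"] assms
    by (simp add: double_commutator_def)
  also have "\<dots> = inv (double_commutator G y x z u) \<otimes> inv (double_commutator G y' x z u)"
    using assms by (simp add: inv_mult_group)
  finally show ?thesis
    using assms double_commutator_swap_left[of _ x z u] by simp
qed

lemma double_commutator_mult34:
  assumes "x \<in> carrier G" "y \<in> carrier G" "z \<in> carrier G" "z' \<in> carrier G" "u \<in> carrier G"
  shows "double_commutator G x y (z \<otimes> z') u
      = double_commutator G x y z u \<otimes> double_commutator G x y z' u"
    and "double_commutator G x y u (z \<otimes> z')
      = double_commutator G x y u z \<otimes> double_commutator G x y u z'"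
proof -
  have *: "inv (double_commutator G p q x y \<otimes> double_commutator G p' q' x y)
      = double_commutator G x y p q \<otimes> double_commutator G x y p' q'"
    if "p \<in> carrier G" "q \<in> carrier G" "p' \<in> carrier G" "q' \<in> carrier G" for p q p' q'
  proof -
    have "double_commutator G p q x y \<otimes> double_commutator G p' q' x y
        = double_commutator G p' q' x y \<otimes> double_commutator G p q x y"
      using double_commutator_commute[of p q x y "commutator G p' q'" "commutator G x y"] assms that
      by (simp add: double_commutator_def)
    then show ?thesis
      using assms that double_commutator_swap[of _ _ x y] by (simp add: inv_mult_group)
  qed
  show "double_commutator G x y (z \<otimes> z') u
      = double_commutator G x y z u \<otimes> double_commutator G x y z' u"
    using assms double_commutator_swap[of "z \<otimes> z'" u x y] *[of z u z' u]
    by (simp add: double_commutator_mult1)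
  show "double_commutator G x y u (z \<otimes> z')
      = double_commutator G x y u z \<otimes> double_commutator G x y u z'"
    using assms double_commutator_swap[of u "z \<otimes> z'" x y] *[of u z u z']
    by (simp add: double_commutator_mult2)
qed

text \<open>The cases where the alternating form must vanish. The last two concern
  \<open>[x, y]\<close> paired with itself or its inverse: two elements have a cyclic exterior
  square.\<close>

lemma double_commutator_one [simp]:
  assumes "x \<in> carrier G" "y \<in> carrier G" "z \<in> carrier G"
  shows "double_commutator G \<one> x y z = \<one>" "double_commutator G x \<one> y z = \<one>"
    "double_commutator G x y \<one> z = \<one>" "double_commutator G x y z \<one> = \<one>"
    "double_commutator G x x y z = \<one>" "double_commutator G x y z z = \<one>"
    "double_commutator G x y x y = \<one>" "double_commutator G x y y x = \<one>"
  using assms double_commutator_swap[of x y y x] double_commutator_swap_left[of x y x y]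
    double_commutator_swap[of x y x y]
  by (auto simp: double_commutator_def)

lemma double_commutator_pow:
  assumes "x \<in> carrier G" "y \<in> carrier G" "z \<in> carrier G" "u \<in> carrier G"
  shows "double_commutator G (x [^] (n::nat)) y z u = double_commutator G x y z u [^] n"
    "double_commutator G x (y [^] n) z u = double_commutator G x y z u [^] n"
    "double_commutator G x y (z [^] n) u = double_commutator G x y z u [^] n"
    "double_commutator G x y z (u [^] n) = double_commutator G x y z u [^] n"
  using assms
  by (induction n)
    (simp_all add: double_commutator_mult1 double_commutator_mult2 double_commutator_mult34)

lemma double_commutator_marginal:
  assumes "x \<in> carrier G" "y \<in> carrier G" "z \<in> carrier G" "a \<in> M"
  shows "double_commutator G x a y z = \<one>" "double_commutator G x y a z = \<one>"
    "double_commutator G x y z a = \<one>"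
proof -
  have "double_commutator G x (\<one> \<otimes> a) y z = double_commutator G x \<one> y z"
    "double_commutator G x y (\<one> \<otimes> a) z = double_commutator G x y \<one> z"
    "double_commutator G x y z (\<one> \<otimes> a) = double_commutator G x y z \<one>"
    using assms mem_marginal_metabelian_iff[of a] by blast+
  then show "double_commutator G x a y z = \<one>" "double_commutator G x y a z = \<one>"
    "double_commutator G x y z a = \<one>"
    using assms by simp_all
qed

text \<open>Each variable of \<open>w(e\<^sub>1\<^sup>N, y, z, u)\<close> can be restricted to generators. If one of them lies in \<open>R\<close>,
  the exponent \<open>N\<close> is moved to it; otherwise \<open>w(e\<^sub>1, y, z, u)\<close> contains a repeated variable or the
  commutator of \<open>[e\<^sub>1, e\<^sub>2]\<close> with itself or its inverse.\<close>

lemma pow_mem_marginal: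
  fixes N :: nat
  defines "R \<equiv> {r \<in> carrier G. r [^] N \<in> M}"
  assumes e: "e1 \<in> carrier G" "e2 \<in> carrier G"
    and gen: "carrier G \<subseteq> generate G ({e1, e2} \<union> R)"
  shows "e1 [^] N \<in> M"
proof -
  let ?a = "e1 [^] N" and ?S = "{e1, e2} \<union> R"
  let ?w = "double_commutator G"
  have S: "?S \<subseteq> carrier G" using e by (auto simp: R_def)
  have all: "f x = \<one>"
    if "\<And>x. x \<in> carrier G \<Longrightarrow> f x \<in> carrier G"
      "\<And>x y. x \<in> carrier G \<Longrightarrow> y \<in> carrier G \<Longrightarrow> f (x \<otimes> y) = f x \<otimes> f y"
      and "\<And>s. s \<in> ?S \<Longrightarrow> f s = \<one>" and "x \<in> carrier G" for f x
  proof -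
    have "generate G ?S \<subseteq> {x \<in> carrier G. f x = \<one>}"
      using S that(3) by (intro generate_subgroup_incl subgroup_vanishing that(1,2)) auto
    then show ?thesis using gen that(4) by auto
  qed
  have 0: "?w ?a y z u = \<one>" if s: "y \<in> ?S" "z \<in> ?S" "u \<in> ?S" for y z u
  proof -
    have c: "y \<in> carrier G" "z \<in> carrier G" "u \<in> carrier G" using s S by auto
    have eq: "?w ?a y z u = ?w e1 (y [^] N) z u" "?w ?a y z u = ?w e1 y (z [^] N) u"
      "?w ?a y z u = ?w e1 y z (u [^] N)" "?w ?a y z u = ?w e1 y z u [^] N"
      using c e by (simp_all add: double_commutator_pow)
    consider "y \<in> R \<or> z \<in> R \<or> u \<in> R" | "{y, z, u} \<subseteq> {e1, e2}" using s by auto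
    then show ?thesis
    proof cases
      case 1
      then show ?thesis
        using c e eq(1-3) by (auto simp: R_def double_commutator_marginal)
    next
      case 2
      then have "?w e1 y z u = \<one>" using e c by auto
      then show ?thesis using eq(4) by simp
    qed
  qed
  have a: "?a \<in> carrier G" using e by simp
  have R: "r \<in> carrier G" if "r \<in> R" for r using that by (simp add: R_def)
  \<comment> \<open>The variables are released from the generating set one at a time, each by
    additivity in that variable; symmetry then moves \<open>?a\<close> to the other
    positions.\<close>
  have 1: "?w ?a y z u = \<one>" if "y \<in> carrier G" "z \<in> ?S" "u \<in> ?S" for y z u
    by (rule all[where f = "\<lambda>y. ?w ?a y z u"]) (use that R e a 0 in \<open>auto simp: double_commutator_mult2\<close>)
  have 2: "?w ?a y z u = \<one>" if "y \<in> carrier G" "z \<in> carrier G" "u \<in> ?S" for y z u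
    by (rule all[where f = "\<lambda>z. ?w ?a y z u"]) (use that R e a 1 in \<open>auto simp: double_commutator_mult34\<close>)
  have 3: "?w ?a y z u = \<one>" if "y \<in> carrier G" "z \<in> carrier G" "u \<in> carrier G" for y z u
    by (rule all[where f = "\<lambda>u. ?w ?a y z u"]) (use that R e a 2 in \<open>auto simp: double_commutator_mult34\<close>)
  have 4: "?w y ?a z u = \<one>" if "y \<in> carrier G" "z \<in> carrier G" "u \<in> carrier G" for y z u
    using that a 3 double_commutator_swap_left[of ?a y z u] by simp
  have 5: "?w y z ?a u = \<one>" "?w y z u ?a = \<one>"
    if "y \<in> carrier G" "z \<in> carrier G" "u \<in> carrier G" for y z u
    using that a 3 4 double_commutator_swap[of ?a u y z] double_commutator_swap[of u ?a y z] by simp_all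
  show ?thesis
    unfolding mem_marginal_metabelian_iff
  proof (intro conjI ballI a)
    fix x y z u assume "x \<in> carrier G" "y \<in> carrier G" "z \<in> carrier G" "u \<in> carrier G"
    then show "?w (x \<otimes> ?a) y z u = ?w x y z u" "?w x (y \<otimes> ?a) z u = ?w x y z u"
      "?w x y (z \<otimes> ?a) u = ?w x y z u" "?w x y z (u \<otimes> ?a) = ?w x y z u"
      using a by (simp_all add: double_commutator_mult1 double_commutator_mult2
        double_commutator_mult34 3 4 5)
  qed
qed

end

section \<open>Capability\<close>

lemma image_group_hom:
  assumes \<phi>: "group_hom E G \<phi>" and j: "inj_on j (carrier E)"
  shows "group_hom (image_group j E) G (\<phi> \<circ> inv_into (carrier E) j)"
    and "kernel (image_group j E) G (\<phi> \<circ> inv_into (carrier E) j) = j ` kernel E G \<phi>"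
    and "j \<in> iso E (image_group j E)"
proof -
  interpret group_hom E G \<phi> by (rule \<phi>)
  show "j \<in> iso E (image_group j E)"
    by (rule inj_imp_image_group_iso[OF j])
  show "group_hom (image_group j E) G (\<phi> \<circ> inv_into (carrier E) j)"
  proof (intro group_hom.intro group_hom_axioms.intro)
    show "group (image_group j E)" by (rule G.inj_imp_image_group_is_group[OF j])
    show "\<phi> \<circ> inv_into (carrier E) j \<in> hom (image_group j E) G"
      using j by (auto simp: hom_def image_group_def)
  qed simp
  show "kernel (image_group j E) G (\<phi> \<circ> inv_into (carrier E) j) = j ` kernel E G \<phi>"
    using j by (force simp: kernel_def image_group_def)
qed

lemma (in group_hom) word_value_hom:
  assumes "g \<in> UNIV \<rightarrow> carrier G"
  shows "word_value H (h \<circ> g) w = h (word_value G g w)"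
proof (induction w)
  case (Cons l w)
  have "g i \<in> carrier G" for i using assms by auto
  then show ?case using Cons assms by (cases l) simp
qed simp

text \<open>As \<open>j\<close> is bijective, the assignments in \<open>F\<close> are exactly the
  \<open>j \<circ> g\<close> with \<open>g\<close> an assignment in \<open>E\<close>, and word
  values correspond under \<open>j\<close>.\<close>

lemma marginal_subgroup_iso:
  assumes "group E" "group F" "j \<in> iso E F"
  shows "marginal_subgroup V F = j ` marginal_subgroup V E"
proof -
  interpret group_hom E F j
    using assms by (auto simp: group_hom_def group_hom_axioms_def iso_def)
  have inj: "inj_on j (carrier E)" and surj: "j ` carrier E = carrier F"
    using assms(3) by (auto simp: iso_def bij_betw_def)
  have "j a \<in> marginal_subgroup V F \<longleftrightarrow> a \<in> marginal_subgroup V E" if a: "a \<in> carrier E" for a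
  proof -
    have *: "word_value F ((j \<circ> g)(i := (j \<circ> g) i \<otimes>\<^bsub>F\<^esub> j a)) v = word_value F (j \<circ> g) v \<longleftrightarrow>
      word_value E (g(i := g i \<otimes>\<^bsub>E\<^esub> a)) v = word_value E g v"
      if g: "g \<in> UNIV \<rightarrow> carrier E" for g i v
    proof -
      have g': "g(i := g i \<otimes>\<^bsub>E\<^esub> a) \<in> UNIV \<rightarrow> carrier E" using g a by (auto simp: Pi_iff)
      have "g i \<in> carrier E" using g by auto
      then have "(j \<circ> g)(i := (j \<circ> g) i \<otimes>\<^bsub>F\<^esub> j a) = j \<circ> g(i := g i \<otimes>\<^bsub>E\<^esub> a)"
        using a by auto
      then show ?thesis
        using word_value_hom[OF g] word_value_hom[OF g'] inj g g'
        by (simp add: inj_on_eq_iff)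
    qed
    have "(\<forall>g\<in>UNIV \<rightarrow> carrier F. P g) \<longleftrightarrow> (\<forall>g\<in>UNIV \<rightarrow> carrier E. P (j \<circ> g))"
      for P :: "(nat \<Rightarrow> _) \<Rightarrow> bool"
    proof
      assume R: "\<forall>g\<in>UNIV \<rightarrow> carrier E. P (j \<circ> g)"
      show "\<forall>g\<in>UNIV \<rightarrow> carrier F. P g"
      proof
        fix g :: "nat \<Rightarrow> _" assume "g \<in> UNIV \<rightarrow> carrier F"
        then have g: "g i \<in> j ` carrier E" for i using surj by auto
        have "inv_into (carrier E) j \<circ> g \<in> UNIV \<rightarrow> carrier E"
          using inv_into_into[OF g] by simp
        with R have "P (j \<circ> (inv_into (carrier E) j \<circ> g))" by blast
        moreover have "j \<circ> (inv_into (carrier E) j \<circ> g) = g"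
          using f_inv_into_f[OF g] by (simp add: fun_eq_iff)
        ultimately show "P g" by simp
      qed
    qed (auto simp: Pi_iff)
    then show ?thesis
      unfolding marginal_subgroup_def using a * by simp
  qed
  moreover have "marginal_subgroup V F \<subseteq> j ` carrier E" "marginal_subgroup V E \<subseteq> carrier E"
    using surj by (auto simp: marginal_subgroup_def)
  ultimately show ?thesis by blast
qed

text \<open>Capability can thus be witnessed by a countable group of any type, given as an
  epimorphism instead of a quotient by cosets.\<close>

lemma variety_capableI:
  fixes E :: "('b, 'm) monoid_scheme"
  assumes "infinite (UNIV :: 'e set)" and \<phi>: "group_hom E G \<phi>"
    and surj: "\<phi> ` carrier E = carrier G" and ker: "kernel E G \<phi> = marginal_subgroup V E"
    and "countable (carrier E)"
  shows "variety_capable TYPE('e) V G"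
proof -
  \<comment> \<open>An infinite type contains a copy of \<open>nat\<close>, into which the countable
    group is enumerated.\<close>
  obtain f :: "nat \<Rightarrow> 'e" where f: "inj f"
    using assms(1) infinite_countable_subset by blast
  define j where "j = f \<circ> to_nat_on (carrier E)"
  have j: "inj_on j (carrier E)"
    unfolding j_def using f assms(5)
    by (intro comp_inj_on inj_on_to_nat_on) (auto intro: inj_on_subset)
  note K = image_group_hom[OF \<phi> j]
  interpret h: group_hom "image_group j E" G "\<phi> \<circ> inv_into (carrier E) j" by (rule K(1))
  have E: "group E" using \<phi> by (simp add: group_hom_def)
  have "(\<phi> \<circ> inv_into (carrier E) j) ` carrier (image_group j E) = carrier G"
    using j surj by (force simp: image_group_def image_comp)
  from h.FactGroup_iso[OF this]
  have "image_group j E Mod marginal_subgroup V (image_group j E) \<cong> G"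
    using marginal_subgroup_iso[OF E h.G.is_group K(3)] K(2) ker by simp
  then have "G \<cong> image_group j E Mod marginal_subgroup V (image_group j E)"
    by (rule group.iso_sym[OF normal.factorgroup_is_group[OF h.G.marginal_subgroup_normal]])
  then show ?thesis
    unfolding variety_capable_def using h.G.is_group by blast
qed

text \<open>Necessity in terms of \<open>G\<close>: the generators are lifted to the covering group
  \<open>E\<close>, where \<open>pow_mem_marginal\<close> puts the power of a lift of
  \<open>e1\<close> into the kernel.\<close>

lemma capable_metabelian_pow_eq_one:
  fixes N :: nat
  assumes capable: "variety_capable TYPE('e) metabelian_words G" and "comm_group G"
    and e: "e1 \<in> carrier G" "e2 \<in> carrier G"
    and gen: "carrier G \<subseteq> generate G ({e1, e2} \<union> {r \<in> carrier G. r [^]\<^bsub>G\<^esub> N = \<one>\<^bsub>G\<^esub>})"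
  shows "e1 [^]\<^bsub>G\<^esub> N = \<one>\<^bsub>G\<^esub>"
proof -
  interpret G: comm_group G by fact
  obtain E :: "'e monoid" where E: "group E"
    and iso: "G \<cong> E Mod marginal_subgroup metabelian_words E"
    using capable unfolding variety_capable_def by blast
  interpret E: group E by fact
  let ?M = "marginal_subgroup metabelian_words E"
  interpret M: normal ?M E by (rule E.marginal_subgroup_normal)
  obtain h where h: "h \<in> iso (E Mod ?M) G"
    using G.iso_sym[OF iso] by (auto simp: is_iso_def)
  define \<phi> where "\<phi> = h \<circ> (#>\<^bsub>E\<^esub>) ?M"
  have "\<phi> \<in> hom E G"
    unfolding \<phi>_def using h by (intro Group.hom_compose[OF M.r_coset_hom_Mod]) (simp add: iso_def)
  then interpret \<phi>: group_hom E G \<phi> by unfold_locales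
  have surj: "\<phi> ` carrier E = carrier G"
    using h by (auto simp: \<phi>_def iso_def bij_betw_def FactGroup_def RCOSETS_def image_iff)
  have ker: "\<phi> x = \<one>\<^bsub>G\<^esub> \<longleftrightarrow> x \<in> ?M" if x: "x \<in> carrier E" for x
  proof -
    have inj: "inj_on h (carrier (E Mod ?M))" using h by (simp add: iso_def bij_betw_def)
    have "?M #>\<^bsub>E\<^esub> x \<in> carrier (E Mod ?M)" "?M \<in> carrier (E Mod ?M)"
      using x monoid.one_closed[OF group.is_monoid[OF M.factorgroup_is_group]]
      by (auto simp: FactGroup_def RCOSETS_def)
    moreover have "h ?M = \<one>\<^bsub>G\<^esub>"
      using hom_one[of h "E Mod ?M" G] h M.factorgroup_is_group G.is_group
      by (simp add: iso_def FactGroup_def)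
    ultimately have "\<phi> x = \<one>\<^bsub>G\<^esub> \<longleftrightarrow> ?M #>\<^bsub>E\<^esub> x = ?M"
      unfolding \<phi>_def using inj by (metis comp_apply inj_onD)
    also have "\<dots> \<longleftrightarrow> x \<in> ?M"
      using x M.is_subgroup M.subset by (metis E.coset_join1 E.coset_join2)
    finally show ?thesis .
  qed
  interpret abelian_marginal_quotient E
  proof
    fix x y assume c: "x \<in> carrier E" "y \<in> carrier E"
    have "\<phi> (commutator E x y) = commutator G (\<phi> x) (\<phi> y)" using c by (simp add: commutator_def)
    also have "\<dots> = \<one>\<^bsub>G\<^esub>" using c by (simp add: G.commutator_eq_one_iff G.m_comm)
    finally show "commutator E x y \<in> ?M" using c ker by simp
  qed
  obtain d1 d2 where d: "d1 \<in> carrier E" "d2 \<in> carrier E" "\<phi> d1 = e1" "\<phi> d2 = e2"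
    using e surj by (metis imageE)
  let ?R = "{r \<in> carrier E. r [^]\<^bsub>E\<^esub> N \<in> ?M}"
  have img: "\<phi> ` generate E ({d1, d2} \<union> ?R) = generate G (\<phi> ` ({d1, d2} \<union> ?R))"
    using d by (intro \<phi>.generate_img[symmetric]) auto
  have "{e1, e2} \<union> {r \<in> carrier G. r [^]\<^bsub>G\<^esub> N = \<one>\<^bsub>G\<^esub>} \<subseteq> \<phi> ` ({d1, d2} \<union> ?R)"
  proof -
    have "r \<in> \<phi> ` ?R" if "r \<in> carrier G" "r [^]\<^bsub>G\<^esub> N = \<one>\<^bsub>G\<^esub>" for r
    proof -
      have "r \<in> \<phi> ` carrier E" using that(1) by (simp add: surj)
      then obtain s where s: "s \<in> carrier E" "r = \<phi> s" by (elim imageE) simp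
      then have "\<phi> (s [^]\<^bsub>E\<^esub> N) = \<one>\<^bsub>G\<^esub>" using that(2) by (simp add: \<phi>.hom_nat_pow)
      then show ?thesis using s ker by auto
    qed
    then show ?thesis using d by auto
  qed
  then have sub: "carrier G \<subseteq> \<phi> ` generate E ({d1, d2} \<union> ?R)"
    unfolding img using gen G.mono_generate by blast
  have "carrier E \<subseteq> generate E ({d1, d2} \<union> ?R)"
  proof
    fix x assume x: "x \<in> carrier E"
    \<comment> \<open>\<open>x\<close> differs from some \<open>s\<close> in the generated subgroup
      by an element of the kernel, and the kernel is contained in \<open>?R\<close>.\<close>
    obtain s where s: "s \<in> generate E ({d1, d2} \<union> ?R)" "\<phi> x = \<phi> s"
      using subsetD[OF sub \<phi>.hom_closed[OF x]] by (elim imageE)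
    have sc: "s \<in> carrier E" using E.generate_in_carrier[OF _ s(1)] d by auto
    have yc: "inv\<^bsub>E\<^esub> s \<otimes>\<^bsub>E\<^esub> x \<in> carrier E" using sc x by simp
    have "\<phi> (inv\<^bsub>E\<^esub> s \<otimes>\<^bsub>E\<^esub> x) = \<one>\<^bsub>G\<^esub>" using s(2) sc x by simp
    then have "\<phi> ((inv\<^bsub>E\<^esub> s \<otimes>\<^bsub>E\<^esub> x) [^]\<^bsub>E\<^esub> N) = \<one>\<^bsub>G\<^esub>"
      using \<phi>.hom_nat_pow[OF yc] by simp
    then have "inv\<^bsub>E\<^esub> s \<otimes>\<^bsub>E\<^esub> x \<in> ?R" using ker yc by simp
    then have "s \<otimes>\<^bsub>E\<^esub> (inv\<^bsub>E\<^esub> s \<otimes>\<^bsub>E\<^esub> x) \<in> generate E ({d1, d2} \<union> ?R)"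
      by (intro generate.eng[OF s(1) generate.incl] UnI2)
    then show "x \<in> generate E ({d1, d2} \<union> ?R)"
      using sc x by (simp add: E.mult_inv_cancel)
  qed
  then have "d1 [^]\<^bsub>E\<^esub> N \<in> ?M" using pow_mem_marginal[of d1 d2 N] d by auto
  then have "\<phi> (d1 [^]\<^bsub>E\<^esub> N) = \<one>\<^bsub>G\<^esub>" using ker d by simp
  then show ?thesis using d by (simp add: \<phi>.hom_nat_pow)
qed

section \<open>Families of unitriangular matrices\<close>

text \<open>Removes the inner reduction from the corner entry of a product bracketed to the
  right.\<close>

lemma mod_add_middle_eq: "(a + (b mod c + d)) mod c = (a + (b + d)) mod (c :: int)"
  by (metis mod_add_left_eq mod_add_right_eq)

type_synonym 'i utri = "('i \<Rightarrow> int) \<times> ('i \<Rightarrow> int) \<times> ('i \<Rightarrow> int) \<times> ('i \<Rightarrow> int) \<times>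
  ('i \<Rightarrow> int) \<times> ('i \<Rightarrow> int) \<times> ('i \<Rightarrow> int)"

text \<open>
  A tuple \<open>(g, a, b, c, d, e, f)\<close> stands for a family, indexed by \<open>i \<in> I\<close>, of upper unitriangular
  \<open>5 \<times> 5\<close> matrices. The superdiagonal is \<open>(g i, g (p i), g (p i), g (q i))\<close>, the next diagonal
  \<open>(a i, b i, c i)\<close>, then \<open>(d i, e i)\<close>, and the corner entry is \<open>f i\<close>, taken modulo \<open>m i\<close>; the
  operation is the matrix product. All matrices of a family share the function \<open>g\<close>.
\<close>

definition utri_group :: "'i set \<Rightarrow> ('i \<Rightarrow> nat) \<Rightarrow> ('i \<Rightarrow> 'i) \<Rightarrow> ('i \<Rightarrow> 'i) \<Rightarrow> 'i utri monoid" where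
  "utri_group I m p q =
    \<lparr>carrier = {(g, a, b, c, d, e, f). {g, a, b, c, d, e} \<subseteq> (I \<rightarrow>\<^sub>E UNIV) \<and>
       f \<in> (\<Pi>\<^sub>E i\<in>I. {x. x mod int (m i) = x})},
     monoid.mult = (\<lambda>(g, a, b, c, d, e, f) (g', a', b', c', d', e', f').
       (\<lambda>i\<in>I. g i + g' i,
        \<lambda>i\<in>I. a i + g i * g' (p i) + a' i,
        \<lambda>i\<in>I. b i + g (p i) * g' (p i) + b' i,
        \<lambda>i\<in>I. c i + g (p i) * g' (q i) + c' i,
        \<lambda>i\<in>I. d i + a i * g' (p i) + g i * b' i + d' i,
        \<lambda>i\<in>I. e i + b i * g' (q i) + g (p i) * c' i + e' i,
        \<lambda>i\<in>I. (f i + (f' i + (d i * g' (q i) + a i * c' i + g i * e' i))) mod int (m i))),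
     one = (\<lambda>i\<in>I. 0, \<lambda>i\<in>I. 0, \<lambda>i\<in>I. 0, \<lambda>i\<in>I. 0, \<lambda>i\<in>I. 0, \<lambda>i\<in>I. 0, \<lambda>i\<in>I. 0)\<rparr>"

text \<open>This is \<open>a c' - a' c\<close>, where \<open>a\<close>, \<open>c\<close> are the
  (1,3) and (3,5) entries of the commutator of the first two matrices and \<open>a'\<close>,
  \<open>c'\<close> those of the other two.\<close>

definition utri_form :: "('i \<Rightarrow> 'i) \<Rightarrow> ('i \<Rightarrow> 'i) \<Rightarrow>
    ('i \<Rightarrow> int) \<Rightarrow> ('i \<Rightarrow> int) \<Rightarrow> ('i \<Rightarrow> int) \<Rightarrow> ('i \<Rightarrow> int) \<Rightarrow> 'i \<Rightarrow> int" where
  "utri_form p q x y z u i =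
    (x i * y (p i) - y i * x (p i)) * (z (p i) * u (q i) - u (p i) * z (q i)) -
    (z i * u (p i) - u i * z (p i)) * (x (p i) * y (q i) - y (p i) * x (q i))"

locale utri =
  fixes I :: "'i set" and m :: "'i \<Rightarrow> nat" and p q :: "'i \<Rightarrow> 'i"
  assumes pq [simp]: "i \<in> I \<Longrightarrow> p i \<in> I" "i \<in> I \<Longrightarrow> q i \<in> I"
begin

abbreviation "U \<equiv> utri_group I m p q"

lemma group_utri: "group U"
proof (rule groupI)
  fix x y assume "x \<in> carrier U" "y \<in> carrier U"
  then show "x \<otimes>\<^bsub>U\<^esub> y \<in> carrier U"
    by (cases x; cases y) (simp add: utri_group_def PiE_iff)
next
  show "\<one>\<^bsub>U\<^esub> \<in> carrier U" by (simp add: utri_group_def PiE_iff)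
next
  fix x y z assume "x \<in> carrier U" "y \<in> carrier U" "z \<in> carrier U"
  then show "x \<otimes>\<^bsub>U\<^esub> y \<otimes>\<^bsub>U\<^esub> z = x \<otimes>\<^bsub>U\<^esub> (y \<otimes>\<^bsub>U\<^esub> z)"
    by (cases x; cases y; cases z)
      (simp add: utri_group_def restrict_def fun_eq_iff mod_add_left_eq mod_add_middle_eq,
        simp add: algebra_simps)
next
  fix x assume "x \<in> carrier U"
  then show "\<one>\<^bsub>U\<^esub> \<otimes>\<^bsub>U\<^esub> x = x"
    by (cases x) (auto simp: utri_group_def restrict_def fun_eq_iff PiE_iff extensional_def)
next
  fix x assume x: "x \<in> carrier U"
  obtain g a b c d e f where xe: "x = (g, a, b, c, d, e, f)" by (cases x)
  \<comment> \<open>The entries of a left inverse, obtained by solving for one diagonal after the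
    other.\<close>
  define a' b' c' where "a' i = g i * g (p i) - a i" and "b' i = g (p i) * g (p i) - b i"
    and "c' i = g (p i) * g (q i) - c i" for i
  define d' e' where "d' i = - a' i * g (p i) + g i * b i - d i"
    and "e' i = - b' i * g (q i) + g (p i) * c i - e i" for i
  define f' where "f' i = (- d' i * g (q i) - a' i * c i + g i * e i - f i) mod int (m i)" for i
  let ?y = "(\<lambda>i\<in>I. - g i, restrict a' I, restrict b' I, restrict c' I, restrict d' I,
    restrict e' I, restrict f' I)"
  have "?y \<in> carrier U" by (simp add: utri_group_def PiE_iff f'_def)
  moreover have "?y \<otimes>\<^bsub>U\<^esub> x = \<one>\<^bsub>U\<^esub>"
    by (simp add: xe utri_group_def restrict_def fun_eq_iff,
        simp add: f'_def mod_add_left_eq)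
      (simp add: a'_def b'_def c'_def d'_def e'_def algebra_simps)
  ultimately show "\<exists>y\<in>carrier U. y \<otimes>\<^bsub>U\<^esub> x = \<one>\<^bsub>U\<^esub>" by blast
qed

sublocale U: group U by (rule group_utri)

lemma countable_utri:
  assumes "finite I"
  shows "countable (carrier U)"
proof -
  have sub: "carrier U \<subseteq> (I \<rightarrow>\<^sub>E UNIV) \<times> (I \<rightarrow>\<^sub>E UNIV) \<times> (I \<rightarrow>\<^sub>E UNIV) \<times> (I \<rightarrow>\<^sub>E UNIV) \<times>
      (I \<rightarrow>\<^sub>E UNIV) \<times> (I \<rightarrow>\<^sub>E UNIV) \<times> (I \<rightarrow>\<^sub>E UNIV)"
    by (auto simp: utri_group_def)
  have "countable (I \<rightarrow>\<^sub>E (UNIV :: int set))" using assms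
    by (induction I rule: finite_induct) (auto simp: PiE_insert_eq)
  then show ?thesis by (intro countable_subset[OF sub] countable_SIGMA)
qed

text \<open>Inverses are avoided by reading \<open>[x, y] = D\<close> as \<open>y x D = x y\<close>.\<close>

lemma commutator_utri:
  assumes x: "x \<in> carrier U" and y: "y \<in> carrier U"
  obtains a b c d e f where
    "commutator U x y = (\<lambda>i\<in>I. 0, a, b, c, d, e, f)"
    "\<And>i. i \<in> I \<Longrightarrow> a i = fst x i * fst y (p i) - fst y i * fst x (p i)"
    "\<And>i. i \<in> I \<Longrightarrow> c i = fst x (p i) * fst y (q i) - fst y (p i) * fst x (q i)"
proof -
  obtain g a b c d e f where D: "commutator U x y = (g, a, b, c, d, e, f)"
    by (cases "commutator U x y")
  have cD: "(g, a, b, c, d, e, f) \<in> carrier U" using x y by (simp flip: D)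
  obtain xg xa xb xc xd xe xf where xt: "x = (xg, xa, xb, xc, xd, xe, xf)" by (cases x)
  obtain yg ya yb yc yd ye yf where yt: "y = (yg, ya, yb, yc, yd, ye, yf)" by (cases y)
  have eq: "y \<otimes>\<^bsub>U\<^esub> x \<otimes>\<^bsub>U\<^esub> (g, a, b, c, d, e, f) = x \<otimes>\<^bsub>U\<^esub> y"
    using U.commutator_eq_iff[OF x y cD] D by simp
  have g: "g i = 0" if "i \<in> I" for i
    using fun_cong[OF arg_cong[OF eq, of fst], of i] that by (simp add: utri_group_def xt yt)
  have "g = (\<lambda>i\<in>I. 0)"
    using g cD by (auto simp: utri_group_def PiE_iff fun_eq_iff extensional_def)
  moreover have "a i = fst x i * fst y (p i) - fst y i * fst x (p i)" if "i \<in> I" for i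
    using fun_cong[OF arg_cong[OF eq, of "fst \<circ> snd"], of i] that g[of "p i"]
    by (simp add: utri_group_def xt yt)
  moreover have "c i = fst x (p i) * fst y (q i) - fst y (p i) * fst x (q i)" if "i \<in> I" for i
    using fun_cong[OF arg_cong[OF eq, of "fst \<circ> snd \<circ> snd \<circ> snd"], of i] that g[of "q i"]
    by (simp add: utri_group_def xt yt)
  ultimately show thesis using that D by blast
qed

text \<open>The inner commutators have zero superdiagonal, so products of their strictly upper parts
  reach only the corner. The candidate \<open>?W\<close> is verified by multiplying out.\<close>

lemma double_commutator_utri:
  assumes c: "x \<in> carrier U" "y \<in> carrier U" "z \<in> carrier U" "u \<in> carrier U"
  shows "double_commutator U x y z u = (\<lambda>i\<in>I. 0, \<lambda>i\<in>I. 0, \<lambda>i\<in>I. 0, \<lambda>i\<in>I. 0, \<lambda>i\<in>I. 0, \<lambda>i\<in>I. 0,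
    \<lambda>i\<in>I. utri_form p q (fst x) (fst y) (fst z) (fst u) i mod int (m i))"
proof -
  obtain a b c d e f where
    D: "commutator U x y = (\<lambda>i\<in>I. 0, a, b, c, d, e, f)"
    "\<And>i. i \<in> I \<Longrightarrow> a i = fst x i * fst y (p i) - fst y i * fst x (p i)"
    "\<And>i. i \<in> I \<Longrightarrow> c i = fst x (p i) * fst y (q i) - fst y (p i) * fst x (q i)"
    using commutator_utri[OF c(1,2)] by blast
  obtain a' b' c' d' e' f' where
    D': "commutator U z u = (\<lambda>i\<in>I. 0, a', b', c', d', e', f')"
    "\<And>i. i \<in> I \<Longrightarrow> a' i = fst z i * fst u (p i) - fst u i * fst z (p i)"
    "\<And>i. i \<in> I \<Longrightarrow> c' i = fst z (p i) * fst u (q i) - fst u (p i) * fst z (q i)"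
    using commutator_utri[OF c(3,4)] by blast
  let ?W = "(\<lambda>i\<in>I. 0, \<lambda>i\<in>I. 0, \<lambda>i\<in>I. 0, \<lambda>i\<in>I. 0, \<lambda>i\<in>I. 0, \<lambda>i\<in>I. 0,
    \<lambda>i\<in>I. (a i * c' i - a' i * c i) mod int (m i))"
  have W: "?W \<in> carrier U" by (simp add: utri_group_def PiE_iff)
  have cD: "commutator U x y \<in> carrier U" "commutator U z u \<in> carrier U" using c by simp_all
  have "double_commutator U x y z u = ?W"
    unfolding double_commutator_def U.commutator_eq_iff[OF cD W] unfolding D(1) D'(1)
    by (simp add: utri_group_def restrict_def fun_eq_iff mod_simps)
      (simp add: algebra_simps)
  also have "\<dots> = (\<lambda>i\<in>I. 0, \<lambda>i\<in>I. 0, \<lambda>i\<in>I. 0, \<lambda>i\<in>I. 0, \<lambda>i\<in>I. 0, \<lambda>i\<in>I. 0,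
    \<lambda>i\<in>I. utri_form p q (fst x) (fst y) (fst z) (fst u) i mod int (m i))"
    by (simp add: restrict_def fun_eq_iff utri_form_def D(2,3) D'(2,3))
  finally show ?thesis .
qed

lemma utri_form_cong:
  assumes "\<And>j. j \<in> {i, p i, q i} \<Longrightarrow> x j mod M = x' j mod M \<and> y j mod M = y' j mod M \<and>
    z j mod M = z' j mod M \<and> u j mod M = u' j mod M"
  shows "utri_form p q x y z u i mod M = utri_form p q x' y' z' u' i mod M"
  unfolding utri_form_def using assms by (intro mod_diff_cong mod_mult_cong) auto

text \<open>The divisibilities make the entries of a member of the right side at \<open>i\<close>,
  \<open>p i\<close>, \<open>q i\<close> vanish modulo \<open>m i\<close>, so it leaves every form
  unchanged. Conversely, evaluation on unit vectors isolates each coordinate.\<close>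

lemma marginal_utri:
  assumes distinct: "\<And>i. i \<in> I \<Longrightarrow> p i \<noteq> i \<and> q i \<noteq> i \<and> p i \<noteq> q i"
    and dvd: "\<And>i. i \<in> I \<Longrightarrow> m i dvd m (p i) \<and> m i dvd m (q i)"
  shows "marginal_subgroup metabelian_words U
    = {x \<in> carrier U. \<forall>i\<in>I. int (m i) dvd fst x i}" (is "?L = ?R")
proof
  have fst_mult: "fst (x \<otimes>\<^bsub>U\<^esub> y) i = fst x i + fst y i" if "i \<in> I" for x y i
    using that by (cases x; cases y) (simp add: utri_group_def)
  show "?R \<subseteq> ?L"
  proof
    fix w assume w: "w \<in> ?R"
    have *: "fst w j mod int (m i) = 0" if "i \<in> I" "j \<in> {i, p i, q i}" for i j
    proof -
      have "int (m i) dvd int (m j)" using that dvd[of i] by auto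
      moreover have "int (m j) dvd fst w j" using w that by auto
      ultimately show ?thesis by (metis dvd_imp_mod_0 dvd_trans)
    qed
    have "(fst x j + fst w j) mod int (m i) = fst x j mod int (m i)"
      if "i \<in> I" "j \<in> {i, p i, q i}" for x :: "'i utri" and i j
      using *[OF that] by (metis add.right_neutral mod_add_right_eq)
    then have cong: "fst (x \<otimes>\<^bsub>U\<^esub> w) j mod int (m i) = fst x j mod int (m i)"
      if "i \<in> I" "j \<in> {i, p i, q i}" for x and i j
      using that fst_mult[of j x w] pq[of i] by (metis insertE singletonD)
    then show "w \<in> ?L"
      unfolding U.mem_marginal_metabelian_iff using w
      by (auto simp: double_commutator_utri intro!: restrict_ext utri_form_cong)
  qed
  show "?L \<subseteq> ?R"
  proof
    fix w assume w: "w \<in> ?L"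
    then have wc: "w \<in> carrier U" by (simp add: U.mem_marginal_metabelian_iff)
    have "int (m i) dvd fst w i" if i: "i \<in> I" for i
    proof -
      \<comment> \<open>Unit vectors on the superdiagonal. As \<open>i\<close>, \<open>p i\<close>,
        \<open>q i\<close> are distinct, the form at \<open>w\<close>,
        \<open>\<delta> (p i)\<close>, \<open>\<delta> (p i)\<close>, \<open>\<delta> (q i)\<close>
        has value \<open>fst w i\<close> at index \<open>i\<close>.\<close>
      define \<delta> :: "'i \<Rightarrow> 'i utri" where
        "\<delta> j = (\<lambda>l\<in>I. if l = j then 1 else 0, \<lambda>i\<in>I. 0, \<lambda>i\<in>I. 0, \<lambda>i\<in>I. 0, \<lambda>i\<in>I. 0, \<lambda>i\<in>I. 0, \<lambda>i\<in>I. 0)" for j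
      have \<delta>: "\<delta> j \<in> carrier U" for j by (simp add: \<delta>_def utri_group_def PiE_iff)
      have "double_commutator U (\<one>\<^bsub>U\<^esub> \<otimes>\<^bsub>U\<^esub> w) (\<delta> (p i)) (\<delta> (p i)) (\<delta> (q i))
          = double_commutator U \<one>\<^bsub>U\<^esub> (\<delta> (p i)) (\<delta> (p i)) (\<delta> (q i))"
        using w \<delta> U.mem_marginal_metabelian_iff by blast
      also have "\<dots> = \<one>\<^bsub>U\<^esub>" using \<delta> by (simp add: double_commutator_def)
      finally have eq: "double_commutator U w (\<delta> (p i)) (\<delta> (p i)) (\<delta> (q i)) = \<one>\<^bsub>U\<^esub>"
        using wc by simp
      have "utri_form p q (fst w) (fst (\<delta> (p i))) (fst (\<delta> (p i))) (fst (\<delta> (q i))) i mod int (m i) = 0"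
        using fun_cong[OF arg_cong[OF eq, of "snd \<circ> snd \<circ> snd \<circ> snd \<circ> snd \<circ> snd"], of i] i
        unfolding double_commutator_utri[OF wc \<delta> \<delta> \<delta>] by (simp add: utri_group_def)
      then show ?thesis
        using distinct[OF i] i pq[OF i] by (auto simp: utri_form_def \<delta>_def split: if_splits)
    qed
    then show "w \<in> ?R" using wc by simp
  qed
qed

end

section \<open>Direct sums of cyclic groups\<close>

lemma int_pow_product_integer_group:
  assumes "x \<in> I \<rightarrow>\<^sub>E UNIV"
  shows "x [^]\<^bsub>product_group I (\<lambda>_. integer_group)\<^esub> (c :: int) = (\<lambda>i\<in>I. c * x i)"
proof -
  let ?P = "product_group I (\<lambda>_. integer_group)"
  have nat: "x [^]\<^bsub>?P\<^esub> (c :: nat) = (\<lambda>i\<in>I. int c * x i)" for c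
    by (induction c) (auto simp: fun_eq_iff algebra_simps)
  have "(\<lambda>i\<in>I. c * x i) \<in> (\<Pi>\<^sub>E i\<in>I. carrier integer_group)" for c by simp
  from inv_product_group[OF this]
  show ?thesis by (auto simp: int_pow_def2 nat fun_eq_iff)
qed

text \<open>\<open>G\<close> as a quotient of integer vectors. An infinite cyclic summand is encoded
  by \<open>m i = 0\<close>: then \<open>0 dvd x i\<close> means \<open>x i = 0\<close>, and
  reduction modulo \<open>m i\<close> in the matrices does nothing.\<close>

locale cyclic_sum_presentation =
  group_hom "product_group I (\<lambda>_. integer_group)" G \<phi>
  for I :: "'i set" and G (structure) and \<phi> +
  fixes m :: "'i \<Rightarrow> nat"
  assumes surj: "\<phi> ` (I \<rightarrow>\<^sub>E UNIV) = carrier G"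
    and ker: "x \<in> I \<rightarrow>\<^sub>E UNIV \<Longrightarrow> \<phi> x = \<one> \<longleftrightarrow> (\<forall>i\<in>I. int (m i) dvd x i)"
begin

text \<open>The covering group consists of the matrix families; reading off the shared function
  \<open>g\<close> and applying \<open>\<phi>\<close> has the marginal subgroup as kernel.\<close>

lemma metabelian_capableI:
  assumes "infinite (UNIV :: 'e set)" "finite I"
    and "\<And>i. i \<in> I \<Longrightarrow> p i \<in> I \<and> q i \<in> I \<and> p i \<noteq> i \<and> q i \<noteq> i \<and> p i \<noteq> q i"
    and "\<And>i. i \<in> I \<Longrightarrow> m i dvd m (p i) \<and> m i dvd m (q i)"
  shows "variety_capable TYPE('e) metabelian_words G"
proof -
  interpret utri I m p q using assms(3) by unfold_locales auto
  have fst: "fst \<in> hom U (product_group I (\<lambda>_. integer_group))"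
    by (auto simp: hom_def utri_group_def)
  have fst_surj: "fst ` carrier U = I \<rightarrow>\<^sub>E UNIV"
  proof
    show "I \<rightarrow>\<^sub>E UNIV \<subseteq> fst ` carrier U"
    proof
      fix x :: "'i \<Rightarrow> int" assume "x \<in> I \<rightarrow>\<^sub>E UNIV"
      then have "(x, \<lambda>i\<in>I. 0, \<lambda>i\<in>I. 0, \<lambda>i\<in>I. 0, \<lambda>i\<in>I. 0, \<lambda>i\<in>I. 0, \<lambda>i\<in>I. 0) \<in> carrier U"
        by (simp add: utri_group_def PiE_iff)
      then show "x \<in> fst ` carrier U" by (metis fst_conv image_eqI)
    qed
  qed (auto simp: utri_group_def)
  show ?thesis
  proof (rule variety_capableI[OF assms(1)])
    show "group_hom U G (\<phi> \<circ> fst)"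
      using Group.hom_compose[OF fst homh] by unfold_locales
    show "(\<phi> \<circ> fst) ` carrier U = carrier G"
      by (simp only: image_comp[symmetric] fst_surj surj)
    have "fst x \<in> I \<rightarrow>\<^sub>E UNIV" if "x \<in> carrier U" for x using that fst_surj by blast
    then show "kernel U G (\<phi> \<circ> fst) = marginal_subgroup metabelian_words U"
      using assms(3,4) by (subst marginal_utri) (auto simp: kernel_def ker)
    show "countable (carrier U)" using assms(2) by (rule countable_utri)
  qed
qed

text \<open>All generators but two are killed by \<open>N\<close>, hence so is the first. The case
  \<open>i1 = i2\<close> is allowed, to cover a single exceptional summand.\<close>

lemma metabelian_capableD:
  assumes "variety_capable TYPE('e) metabelian_words G" "comm_group G"
    and i: "i1 \<in> I" "i2 \<in> I" and N: "\<And>i. i \<in> I \<Longrightarrow> i \<noteq> i1 \<Longrightarrow> i \<noteq> i2 \<Longrightarrow> m i dvd N"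
  shows "m i1 dvd N"
proof -
  let ?P = "product_group I (\<lambda>_. integer_group)"
  define \<delta> :: "'i \<Rightarrow> 'i \<Rightarrow> int" where "\<delta> j = (\<lambda>i\<in>I. if i = j then 1 else 0)" for j
  have \<delta>: "\<delta> j \<in> I \<rightarrow>\<^sub>E UNIV" for j by (simp add: \<delta>_def)
  have c: "\<phi> x \<in> carrier G" if "x \<in> I \<rightarrow>\<^sub>E UNIV" for x using that surj by blast
  have pow: "\<phi> x [^] c = \<phi> (\<lambda>i\<in>I. c * x i)" if "x \<in> I \<rightarrow>\<^sub>E UNIV" for x and c :: int
    using that hom_int_pow[of x c] by (simp add: int_pow_product_integer_group)
  let ?S = "{\<phi> (\<delta> i1), \<phi> (\<delta> i2)} \<union> {r \<in> carrier G. r [^] N = \<one>}"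
  have S: "?S \<subseteq> carrier G" using c \<delta> by auto
  have gen: "carrier G \<subseteq> generate G ?S"
  proof
    fix y assume "y \<in> carrier G"
    then obtain x where x: "x \<in> I \<rightarrow>\<^sub>E UNIV" "y = \<phi> x" using surj by blast
    define r where "r = (\<lambda>i\<in>I. if i = i1 \<or> i = i2 then 0 else x i)"
    \<comment> \<open>The value 0 avoids counting the same coordinate twice when
      \<open>i1 = i2\<close>.\<close>
    define d where "d = (if i1 = i2 then 0 else x i2)"
    have r: "r \<in> I \<rightarrow>\<^sub>E UNIV" by (simp add: r_def)
    have AB: "(\<lambda>i\<in>I. x i1 * \<delta> i1 i) \<otimes>\<^bsub>?P\<^esub> (\<lambda>i\<in>I. d * \<delta> i2 i) \<in> I \<rightarrow>\<^sub>E UNIV"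
      by simp
    have "\<phi> r [^] N = \<phi> (\<lambda>i\<in>I. int N * r i)"
      using pow[OF r, of "int N"] by (simp add: int_pow_int)
    also have "\<dots> = \<one>"
      using N by (subst ker) (auto simp: r_def)
    finally have "\<phi> r \<in> generate G ?S" using c[OF r] by (intro generate.incl) auto
    moreover have "\<phi> (\<delta> i1) [^] x i1 \<in> generate G ?S" "\<phi> (\<delta> i2) [^] d \<in> generate G ?S"
      by (rule H.subgroup_int_pow_closed[OF H.generate_is_subgroup[OF S]]; simp add: generate.incl)+
    ultimately have "\<phi> (\<delta> i1) [^] x i1 \<otimes> \<phi> (\<delta> i2) [^] d \<otimes> \<phi> r \<in> generate G ?S"
      by (intro generate.eng)
    moreover have "\<phi> (\<delta> i1) [^] x i1 \<otimes> \<phi> (\<delta> i2) [^] d \<otimes> \<phi> r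
      = \<phi> ((\<lambda>i\<in>I. x i1 * \<delta> i1 i) \<otimes>\<^bsub>?P\<^esub> (\<lambda>i\<in>I. d * \<delta> i2 i) \<otimes>\<^bsub>?P\<^esub> r)"
      using \<delta> r AB by (simp add: pow hom_mult[symmetric] del: hom_mult mult_product_group)
    moreover have "(\<lambda>i\<in>I. x i1 * \<delta> i1 i) \<otimes>\<^bsub>?P\<^esub> (\<lambda>i\<in>I. d * \<delta> i2 i) \<otimes>\<^bsub>?P\<^esub> r = x"
      using x(1) by (auto simp: fun_eq_iff \<delta>_def d_def r_def PiE_iff extensional_def)
    ultimately show "y \<in> generate G ?S" using x(2) by simp
  qed
  have "\<phi> (\<delta> i1) [^] N = \<one>"
    using capable_metabelian_pow_eq_one[OF assms(1,2) _ _ gen] c \<delta> by blast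
  then have "\<phi> (\<lambda>i\<in>I. int N * \<delta> i1 i) = \<one>"
    using pow[OF \<delta>, of _ "int N"] by (simp add: int_pow_int)
  then show ?thesis using ker[of "\<lambda>i\<in>I. int N * \<delta> i1 i"] i by (auto simp: \<delta>_def)
qed

end

text \<open>Both sums are indexed jointly: the infinite summands come first and the finite ones are
  shifted by \<open>k\<close>. Reducing the shifted coordinates gives the map \<open>\<psi>\<close>
  onto the direct sum.\<close>

lemma cyclic_sum_presentation_sum_group:
  fixes G :: "('a, 'm) monoid_scheme" and k t :: nat and n :: "nat \<Rightarrow> nat"
  assumes "group G" and "G \<cong> sum_group {1..k} (\<lambda>_. integer_group)
              \<times>\<times> sum_group {1..t} (\<lambda>i. integer_mod_group (n i))"
    and n: "\<And>i. 1 \<le> i \<Longrightarrow> i \<le> t \<Longrightarrow> n i \<ge> 1"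
  obtains \<phi> where "cyclic_sum_presentation {1..k + t} G \<phi> (\<lambda>i. if i \<le> k then 0 else n (i - k))"
proof -
  let ?A = "sum_group {1..k} (\<lambda>_. integer_group)"
  let ?B = "sum_group {1..t} (\<lambda>i. integer_mod_group (n i))"
  let ?P = "product_group {1..k + t} (\<lambda>_. integer_group)"
  interpret group G by fact
  have gr: "group (?A \<times>\<times> ?B)" by (simp add: DirProd_group)
  obtain h where h: "h \<in> iso (?A \<times>\<times> ?B) G" using iso_sym[OF assms(2)] by (auto simp: is_iso_def)
  define \<psi> where "\<psi> x = (\<lambda>i\<in>{1..k}. x i, \<lambda>i\<in>{1..t}. x (k + i) mod int (n i))" for x :: "nat \<Rightarrow> int"
  have cA: "carrier ?A = {1..k} \<rightarrow>\<^sub>E UNIV" by (simp add: carrier_sum_group)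
  have cB: "carrier ?B = (\<Pi>\<^sub>E i\<in>{1..t}. {0..<int (n i)})"
  proof -
    have "carrier (integer_mod_group (n i)) = {0..<int (n i)}" if "i \<in> {1..t}" for i
      using n[of i] that by (simp add: carrier_integer_mod_group)
    then have "(\<Pi>\<^sub>E i\<in>{1..t}. carrier (integer_mod_group (n i))) = (\<Pi>\<^sub>E i\<in>{1..t}. {0..<int (n i)})"
      by (rule PiE_cong)
    then show ?thesis by (simp add: carrier_sum_group)
  qed
  have cAB: "carrier (?A \<times>\<times> ?B) = ({1..k} \<rightarrow>\<^sub>E UNIV) \<times> (\<Pi>\<^sub>E i\<in>{1..t}. {0..<int (n i)})"
    by (simp add: DirProd_def cA cB del: One_nat_def)
  have n_pos: "0 < int (n i)" if "i \<in> {1..t}" for i using n[of i] that by simp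
  have \<psi>c: "\<psi> x \<in> carrier (?A \<times>\<times> ?B)" for x
    unfolding cAB \<psi>_def using n_pos by (auto simp del: One_nat_def)
  have \<psi>: "\<psi> \<in> hom ?P (?A \<times>\<times> ?B)"
    using \<psi>c by (auto simp: hom_def) (auto simp: \<psi>_def DirProd_def fun_eq_iff mod_add_eq)
  have \<psi>_surj: "\<psi> ` ({1..k + t} \<rightarrow>\<^sub>E UNIV) = carrier (?A \<times>\<times> ?B)"
  proof
    show "carrier (?A \<times>\<times> ?B) \<subseteq> \<psi> ` ({1..k + t} \<rightarrow>\<^sub>E UNIV)"
    proof
      fix y assume "y \<in> carrier (?A \<times>\<times> ?B)"
      then obtain a b where y: "y = (a, b)" "a \<in> {1..k} \<rightarrow>\<^sub>E UNIV" "b \<in> (\<Pi>\<^sub>E i\<in>{1..t}. {0..<int (n i)})"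
        unfolding cAB by blast
      define x where "x = (\<lambda>i\<in>{1..k + t}. if i \<le> k then a i else b (i - k))"
      have "\<psi> x = y"
        using y by (auto simp: \<psi>_def x_def fun_eq_iff PiE_iff extensional_def)
      moreover have "x \<in> {1..k + t} \<rightarrow>\<^sub>E UNIV" by (simp add: x_def)
      ultimately show "y \<in> \<psi> ` ({1..k + t} \<rightarrow>\<^sub>E UNIV)" by blast
    qed
  qed (use \<psi>c in blast)
  have \<psi>_ker: "\<psi> x = \<one>\<^bsub>?A \<times>\<times> ?B\<^esub> \<longleftrightarrow>
      (\<forall>i\<in>{1..k + t}. int (if i \<le> k then 0 else n (i - k)) dvd x i)" for x
  proof -
    have "\<psi> x = \<one>\<^bsub>?A \<times>\<times> ?B\<^esub> \<longleftrightarrow> (\<forall>i\<in>{1..k}. x i = 0) \<and> (\<forall>i\<in>{1..t}. int (n i) dvd x (k + i))"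
      by (auto simp: \<psi>_def DirProd_def fun_eq_iff dvd_eq_mod_eq_0)
    also have "\<dots> \<longleftrightarrow> (\<forall>i\<in>{1..k + t}. int (if i \<le> k then 0 else n (i - k)) dvd x i)"
      (is "?l \<longleftrightarrow> ?r")
    proof
      assume l: ?l
      show ?r
      proof
        fix i assume "i \<in> {1..k + t}"
        then show "int (if i \<le> k then 0 else n (i - k)) dvd x i"
          using l by (cases "i \<le> k") (auto dest!: bspec[of _ _ "i - k"])
      qed
    next
      assume r: ?r
      show ?l
      proof (intro conjI ballI)
        fix i assume "i \<in> {1..k}"
        then show "x i = 0" using bspec[OF r, of i] by auto
      next
        fix i assume "i \<in> {1..t}"
        then show "int (n i) dvd x (k + i)" using bspec[OF r, of "k + i"] by auto
      qed
    qed
    finally show ?thesis .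
  qed
  have inj: "h y = \<one>\<^bsub>G\<^esub> \<longleftrightarrow> y = \<one>\<^bsub>?A \<times>\<times> ?B\<^esub>" if "y \<in> carrier (?A \<times>\<times> ?B)" for y
  proof -
    have "h \<one>\<^bsub>?A \<times>\<times> ?B\<^esub> = \<one>\<^bsub>G\<^esub>"
      using h hom_one[OF _ gr is_group] by (auto simp: iso_def)
    moreover have "\<one>\<^bsub>?A \<times>\<times> ?B\<^esub> \<in> carrier (?A \<times>\<times> ?B)"
      by (rule monoid.one_closed[OF group.is_monoid[OF gr]])
    ultimately show ?thesis using h that by (metis (no_types, lifting) bij_betw_def inj_onD iso_def mem_Collect_eq)
  qed
  show thesis
  proof (rule that[of "h \<circ> \<psi>"], intro cyclic_sum_presentation.intro group_hom.intro
      group_hom_axioms.intro cyclic_sum_presentation_axioms.intro)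
    show "h \<circ> \<psi> \<in> hom ?P G" using h by (intro Group.hom_compose[OF \<psi>]) (simp add: iso_def)
    show "(h \<circ> \<psi>) ` ({1..k + t} \<rightarrow>\<^sub>E UNIV) = carrier G"
      using h unfolding image_comp[symmetric] \<psi>_surj by (simp add: iso_def bij_betw_def)
    show "(h \<circ> \<psi>) x = \<one>\<^bsub>G\<^esub> \<longleftrightarrow>
        (\<forall>i\<in>{1..k + t}. int (if i \<le> k then 0 else n (i - k)) dvd x i)" for x
      using inj[OF \<psi>c] \<psi>_ker by simp
  qed (simp_all add: is_group)
qed

text \<open>The trivial group is excluded because it is capable, as a quotient of itself, although
  with \<open>k = t = 0\<close> it satisfies neither alternative.\<close>

theorem theorem3p7:
  fixes G :: "('a, 'm) monoid_scheme" and k t :: nat and n :: "nat \<Rightarrow> nat"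
  assumes "infinite (UNIV :: 'e set)"
    and "group G"
    and "\<And>i. 1 \<le> i \<Longrightarrow> i \<le> t \<Longrightarrow> n i \<ge> 1"
    and "\<And>i. 1 \<le> i \<Longrightarrow> i \<le> t - 1 \<Longrightarrow> n (i + 1) dvd n i"
    and "G \<cong> sum_group {1..k} (\<lambda>_. integer_group)
              \<times>\<times> sum_group {1..t} (\<lambda>i. integer_mod_group (n i))"
    and "\<not> trivial_group G"
  shows "variety_capable TYPE('e) metabelian_words G \<longleftrightarrow>
           k \<ge> 3 \<or> (k = 0 \<and> t \<ge> 3 \<and> n 1 = n 2 \<and> n 2 = n 3)"
proof -
  define m where "m i = (if i \<le> k then 0 else n (i - k))" for i
  obtain \<phi> where pres: "cyclic_sum_presentation {1..k + t} G \<phi> m"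
    using cyclic_sum_presentation_sum_group[OF assms(2,5,3)] unfolding m_def by blast
  interpret cyclic_sum_presentation "{1..k + t}" G \<phi> m by (rule pres)
  have comm: "comm_group G"
  proof (rule H.group_comm_groupI)
    fix x y assume "x \<in> carrier G" "y \<in> carrier G"
    then obtain a b where ab: "x = \<phi> a" "y = \<phi> b"
      "a \<in> {1..k + t} \<rightarrow>\<^sub>E UNIV" "b \<in> {1..k + t} \<rightarrow>\<^sub>E UNIV" unfolding surj[symmetric] by blast
    let ?P = "product_group {1..k + t} (\<lambda>_. integer_group)"
    have "a \<otimes>\<^bsub>?P\<^esub> b = b \<otimes>\<^bsub>?P\<^esub> a" by (simp add: add.commute)
    then show "x \<otimes>\<^bsub>G\<^esub> y = y \<otimes>\<^bsub>G\<^esub> x"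
      using ab hom_mult[of a b] hom_mult[of b a] by (simp del: mult_product_group)
  qed
  have dvd: "n j dvd n i" if "1 \<le> i" "i \<le> j" "j \<le> t" for i j
    using that(2,3)
  proof (induction j rule: dec_induct)
    case (step j)
    then have "n (j + 1) dvd n j" using that(1) by (intro assms(4)) auto
    with step show ?case by (auto intro: dvd_trans)
  qed simp
  have nontriv: "\<exists>i\<in>{1..k + t}. m i \<noteq> 1"
  proof (rule ccontr)
    assume "\<not> ?thesis"
    then have "\<phi> x = \<one>\<^bsub>G\<^esub>" if "x \<in> {1..k + t} \<rightarrow>\<^sub>E UNIV" for x using that by (subst ker) auto
    then have "carrier G = {\<one>\<^bsub>G\<^esub>}" using surj H.one_closed by auto
    then show False using assms(6) H.is_group by (simp add: trivial_group_def)
  qed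
  show ?thesis
  proof
    assume R: "k \<ge> 3 \<or> (k = 0 \<and> t \<ge> 3 \<and> n 1 = n 2 \<and> n 2 = n 3)"
    \<comment> \<open>Each index receives two of 1, 2, 3 different from itself. These summands are
      infinite if \<open>k \<ge> 3\<close>, and otherwise have the largest order
      \<open>n 1\<close>.\<close>
    define p q where "p i = (if i = 1 then 2 else 1 :: nat)"
      and "q i = (if i \<le> 2 then 3 else 2 :: nat)" for i :: nat
    have m123: "m i dvd m j" if "i \<in> {1..k + t}" "j \<in> {1, 2, 3}" for i j
    proof (cases "k \<ge> 3")
      case True
      then show ?thesis using that(2) by (auto simp: m_def)
    next
      case False
      then have "m i dvd n 1" "m j = n 1" using R dvd[of 1 i] that by (auto simp: m_def)
      then show ?thesis by simp
    qed
    show "variety_capable TYPE('e) metabelian_words G"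
    proof (rule metabelian_capableI[OF assms(1), of p q])
      fix i assume i: "i \<in> {1..k + t}"
      show "p i \<in> {1..k + t} \<and> q i \<in> {1..k + t} \<and> p i \<noteq> i \<and> q i \<noteq> i \<and> p i \<noteq> q i"
        using R i by (auto simp: p_def q_def)
      show "m i dvd m (p i) \<and> m i dvd m (q i)"
        using i by (auto intro!: m123 simp: p_def q_def)
    qed simp
  next
    assume L: "variety_capable TYPE('e) metabelian_words G"
    show "k \<ge> 3 \<or> (k = 0 \<and> t \<ge> 3 \<and> n 1 = n 2 \<and> n 2 = n 3)"
    proof (rule ccontr)
      assume R: "\<not> ?thesis"
      show False
      proof (cases "k = 0")
        case False
        \<comment> \<open>For \<open>k\<close> equal to 1 or 2, the indices 1 and \<open>k\<close>
          exhaust the infinite summands and \<open>n 1\<close> kills the rest. Then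
          \<open>m 1 = 0\<close> would divide a positive number.\<close>
        define N where "N = (if t = 0 then 1 else n 1)"
        have "m 1 dvd N"
        proof (rule metabelian_capableD[OF L comm, of 1 k])
          fix i assume "i \<in> {1..k + t}" "i \<noteq> 1" "i \<noteq> k"
          then show "m i dvd N" using R False dvd[of 1 "i - k"] by (auto simp: m_def N_def)
        qed (use False in auto)
        then show False using False assms(3)[of 1] by (auto simp: m_def N_def split: if_splits)
      next
        case True
        have t: "t \<ge> 1" using nontriv True by auto
        \<comment> \<open>\<open>n 3\<close> kills all summands after the first two. For
          \<open>t < 3\<close> none remain, so \<open>N = 1\<close> forces every order to be 1;
          \<open>min 2 t\<close> falls back to index 1 if \<open>t = 1\<close>.\<close>
        define N where "N = (if t \<ge> 3 then n 3 else 1)"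
        have "m 1 dvd N"
        proof (rule metabelian_capableD[OF L comm, of 1 "min 2 t"])
          fix i assume "i \<in> {1..k + t}" "i \<noteq> 1" "i \<noteq> min 2 t"
          then show "m i dvd N" using True dvd[of 3 i] by (auto simp: m_def N_def)
        qed (use True t in auto)
        then have n1: "n 1 dvd N" using True by (simp add: m_def)
        show False
        proof (cases "t \<ge> 3")
          case t3: True
          then have "n 1 dvd n 3" "n 2 dvd n 1" "n 3 dvd n 2"
            using n1 dvd[of 1 2] dvd[of 2 3] by (auto simp: N_def)
          then have "n 1 = n 2 \<and> n 2 = n 3" by (meson dvd_antisym dvd_trans)
          then show False using R True t3 by simp
        next
          case False
          then have "n i = 1" if "i \<in> {1..t}" for i
            using n1 dvd[of 1 i] that by (auto simp: N_def)
          then show False using nontriv True by (auto simp: m_def)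
        qed
      qed
    qed
  qed
qed

end
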